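(* Let $\mathbb{F}_q$ be a finite field with $q$ elements, let $A\subset\mathbb{F}_q$ with $|A|>\sqrt q$, and let $E=A\times A\times A\times A\subset\mathbb{F}_q^4$. Then $$vol(E)=\mathbb{F}_q.$$
   Context: For $x^1,\dots,x^4\in\mathbb{F}_q^4$, $vol(x^1,x^2,x^3,x^4)$ is the determinant of the $4\times4$ matrix with rows $x^1,x^2,x^3,x^4$, and $vol(E)=\{vol(x^1,x^2,x^3,x^4): x^j\in E\}\subset\mathbb{F}_q$. *)

theory Defs
  imports "HOL-Analysis.Analysis"
begin

definition vol :: "'a::field^4 \<Rightarrow> 'a^4 \<Rightarrow> 'a^4 \<Rightarrow> 'a^4 \<Rightarrow> 'a" where
  "vol x1 x2 x3 x4 = det (vector [x1, x2, x3, x4] :: 'a^4^4)"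

definition vol_set :: "('a::field^4) set \<Rightarrow> 'a set" where
  "vol_set E = {vol x1 x2 x3 x4 | x1 x2 x3 x4. x1 \<in> E \<and> x2 \<in> E \<and> x3 \<in> E \<and> x4 \<in> E}"

text \<open>The product \<open>A \<times> A \<times> A \<times> A\<close>, as a subset of the coordinate space \<open>'a^4\<close>.\<close>
definition cart_power4 :: "'a set \<Rightarrow> ('a^4) set" where
  "cart_power4 A = {x. \<forall>i. x $ i \<in> A}"

text \<open>Sanity check for \<open>vector\<close>: the rows are the four listed vectors, in order
  (the index \<open>4\<close> of type \<open>4\<close> is \<open>0\<close>).\<close>
lemma row_vector_4:
  fixes x1 x2 x3 x4 :: "'a::field^4"
  shows "row 1 (vector [x1, x2, x3, x4] :: 'a^4^4) = x1"
    and "row 2 (vector [x1, x2, x3, x4] :: 'a^4^4) = x2"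
    and "row 3 (vector [x1, x2, x3, x4] :: 'a^4^4) = x3"
    and "row 4 (vector [x1, x2, x3, x4] :: 'a^4^4) = x4"
  by (simp_all add: row_def vector_def)

end

theory Submission
  imports Defs
begin

text \<open>
  For a suitable \<open>\<xi>\<close> the set \<open>S = A + \<xi> A\<close> has more than \<open>q/2\<close> elements, by averaging
  the number of coincidences \<open>a + \<xi> b = a' + \<xi> b'\<close> over all \<open>\<xi>\<close>; hence \<open>S - S\<close> is the whole field.
  Since \<open>|A|^2 > q\<close>, the map \<open>(a, b) \<mapsto> a + \<xi> b\<close> on \<open>A \<times> A\<close> has a coincidence
  \<open>r + \<xi> s = p + \<xi> q\<close> with \<open>q \<noteq> s\<close>.  Then the vector \<open>(1, \<xi>, -1, -\<xi>)\<close> spans the kernel of the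
  \<open>3 \<times> 4\<close> matrix with rows \<open>(a,a,a,a)\<close>, \<open>(a,b,a,b)\<close>, \<open>(p,q,r,s)\<close>, where \<open>a \<noteq> 0\<close> and \<open>b \<noteq> a\<close>.  Putting a
  row \<open>(x,y,z,w)\<close> on top gives a determinant that is a fixed nonzero multiple of
  \<open>(z + \<xi> w) - (x + \<xi> y)\<close>, a general element of \<open>S - S\<close>.
\<close>

text \<open>Cauchy-Schwarz for the fibre sizes of \<open>f\<close>: they sum to
  \<open>card X\<close>, and their squares sum to the number of colliding pairs.\<close>

lemma card_power2_le_image_times_collisions:
  assumes "finite X"
  shows "(card X)\<^sup>2 \<le> card (f ` X) * card {(u, v) \<in> X \<times> X. f u = f v}"
proof -
  let ?fib = "\<lambda>y. {x \<in> X. f x = y}"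
  have X: "X = (\<Union>y\<in>f ` X. ?fib y)" by auto
  have "card X = (\<Sum>y\<in>f ` X. card (?fib y))"
    by (subst X, rule card_UN_disjoint) (use assms in auto)
  moreover have "{(u, v) \<in> X \<times> X. f u = f v} = (\<Union>y\<in>f ` X. ?fib y \<times> ?fib y)" by auto
  then have "card {(u, v) \<in> X \<times> X. f u = f v} = (\<Sum>y\<in>f ` X. card (?fib y \<times> ?fib y))"
    by (simp only:) (rule card_UN_disjoint, use assms in auto)
  moreover have "(\<Sum>y\<in>f ` X. real (card (?fib y)))\<^sup>2
      \<le> real (card (f ` X)) * (\<Sum>y\<in>f ` X. (real (card (?fib y)))\<^sup>2)"
    using Cauchy_Schwarz_ineq_sum[of "\<lambda>_. 1" "\<lambda>y. real (card (?fib y))" "f ` X"] by simp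
  ultimately have "real ((card X)\<^sup>2)
      \<le> real (card (f ` X) * card {(u, v) \<in> X \<times> X. f u = f v})"
    by (simp add: card_cartesian_product power2_eq_square)
  then show ?thesis by (simp only: of_nat_le_iff)
qed

text \<open>Count by pairs instead of by \<xi>: a diagonal pair collides for every \<xi>, any other
  pair for at most one.\<close>

lemma sum_card_line_collisions_le:
  fixes X :: "('a::{field,finite} \<times> 'a) set"
  shows "(\<Sum>\<xi>\<in>UNIV. card {(u, v) \<in> X \<times> X. fst u + \<xi> * snd u = fst v + \<xi> * snd v})
    \<le> CARD('a) * card X + card X * (card X - 1)"
proof -
  let ?L = "\<lambda>\<xi> (u::'a \<times> 'a). fst u + \<xi> * snd u"
  let ?Xi = "\<lambda>w. {\<xi>. ?L \<xi> (fst w) = ?L \<xi> (snd w)}"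
  let ?D = "(\<lambda>u. (u, u)) ` X"
  have D: "?D \<subseteq> X \<times> X" "card ?D = card X"
    by (auto intro!: card_image inj_onI)
  have one: "card (?Xi w) \<le> 1" if "w \<in> X \<times> X - ?D" for w
  proof -
    have ne: "fst w \<noteq> snd w" using that by (cases w) auto
    have "\<xi> = \<eta>" if "\<xi> \<in> ?Xi w" "\<eta> \<in> ?Xi w" for \<xi> \<eta>
    proof (rule ccontr)
      assume "\<xi> \<noteq> \<eta>"
      \<comment> \<open>Comparing the collision at two slopes cancels the first coordinates.\<close>
      have "(\<xi> - \<eta>) * (snd (fst w) - snd (snd w))
          = (?L \<xi> (fst w) - ?L \<xi> (snd w)) - (?L \<eta> (fst w) - ?L \<eta> (snd w))"
        by (simp add: algebra_simps)
      also have "\<dots> = 0" using that by simp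
      finally have "snd (fst w) = snd (snd w)" using \<open>\<xi> \<noteq> \<eta>\<close> by simp
      moreover from this have "fst (fst w) = fst (snd w)"
        using that(1) by (auto split: if_splits)
      ultimately show False using ne by (simp add: prod_eq_iff)
    qed
    then show ?thesis by (auto simp: card_le_Suc0_iff_eq)
  qed
  have "(\<Sum>\<xi>\<in>UNIV. card {(u, v) \<in> X \<times> X. ?L \<xi> u = ?L \<xi> v})
      = (\<Sum>\<xi>\<in>UNIV. card {w \<in> X \<times> X. ?L \<xi> (fst w) = ?L \<xi> (snd w)})"
    by (intro sum.cong arg_cong[where f = card]) auto
  also have "\<dots> = (\<Sum>w\<in>X \<times> X. card {\<xi> \<in> UNIV. ?L \<xi> (fst w) = ?L \<xi> (snd w)})"
    by (rule sum_multicount_gen) auto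
  also have "\<dots> = (\<Sum>w\<in>X \<times> X - ?D. card (?Xi w)) + (\<Sum>w\<in>?D. card (?Xi w))"
    using sum.subset_diff[OF D(1)] by simp
  also have "\<dots> \<le> (\<Sum>w\<in>X \<times> X - ?D. 1) + (\<Sum>w\<in>?D. CARD('a))"
    by (intro add_mono sum_mono one card_mono) auto
  also have "\<dots> = CARD('a) * card X + card X * (card X - 1)"
    using D by (simp add: card_Diff_subset card_cartesian_product diff_mult_distrib2 ac_simps)
  finally show ?thesis .
qed

lemma exists_line_image_gt_half:
  fixes X :: "('a::{field,finite} \<times> 'a) set"
  assumes "CARD('a) \<le> card X"
  shows "\<exists>\<xi>. CARD('a) < 2 * card ((\<lambda>u. fst u + \<xi> * snd u) ` X)"
proof (rule ccontr)
  let ?q = "CARD('a)" and ?N = "card X"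
  let ?E = "\<lambda>\<xi>. card {(u, v) \<in> X \<times> X. fst u + \<xi> * snd u = fst v + \<xi> * snd v}"
  assume "\<not> ?thesis"
  then have small: "2 * card ((\<lambda>u. fst u + \<xi> * snd u) ` X) \<le> ?q" for \<xi>
    by (simp add: not_less)
  have "2 * ?N\<^sup>2 \<le> ?q * ?E \<xi>" for \<xi>
  proof -
    have "2 * ?N\<^sup>2 \<le> 2 * (card ((\<lambda>u. fst u + \<xi> * snd u) ` X) * ?E \<xi>)"
      by (intro mult_left_mono card_power2_le_image_times_collisions) auto
    also have "\<dots> \<le> ?q * ?E \<xi>"
      unfolding mult.assoc[symmetric] by (intro mult_right_mono small) auto
    finally show ?thesis .
  qed
  then have "(\<Sum>\<xi>\<in>(UNIV::'a set). 2 * ?N\<^sup>2) \<le> (\<Sum>\<xi>\<in>UNIV. ?q * ?E \<xi>)"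
    by (rule sum_mono)
  then have "?q * (2 * ?N\<^sup>2) \<le> ?q * (\<Sum>\<xi>\<in>UNIV. ?E \<xi>)"
    by (simp add: sum_distrib_left)
  also have "\<dots> \<le> ?q * (?q * ?N + ?N * (?N - 1))"
    by (intro mult_left_mono sum_card_line_collisions_le) auto
  finally have "2 * ?N\<^sup>2 \<le> ?q * ?N + ?N * (?N - 1)"
    by simp
  \<comment> \<open>Dividing by \<open>?N > 0\<close> gives \<open>?N + 1 \<le> ?q\<close>, against
    the assumption.\<close>
  then have "?N * (2 * ?N) \<le> ?N * (?q + (?N - 1))"
    by (simp only: power2_eq_square distrib_left ac_simps)
  moreover have "?N > 0" using assms zero_less_card_finite[where 'a='a] by linarith
  ultimately show False using assms by simp
qed

text \<open>\<open>S\<close> and its translate by \<open>t\<close> each fill more than half of the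
  group, so they meet.\<close>

lemma exists_diff_of_card_gt_half:
  fixes S :: "'a::{ab_group_add,finite} set"
  assumes "CARD('a) < 2 * card S"
  shows "\<exists>u\<in>S. \<exists>v\<in>S. t = u - v"
proof -
  have "S \<inter> (+) t ` S \<noteq> {}"
  proof
    assume "S \<inter> (+) t ` S = {}"
    then have "card S + card ((+) t ` S) = card (S \<union> (+) t ` S)"
      by (simp add: card_Un_disjoint)
    also have "\<dots> \<le> CARD('a)" by (intro card_mono) auto
    finally show False using assms by (simp add: card_image)
  qed
  then show ?thesis by (force simp: algebra_simps)
qed

text \<open>Subtract column 1 from column 3 and column 2 from column 4: the middle rows split off
  the factor \<open>a * (b - a)\<close>, and the collision \<open>r - p = - \<xi> * (s - q)\<close>
  makes the remaining 2 by 2 minor factor.\<close>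

lemma vol_eq_of_collision:
  fixes a b p q r s x y z w \<xi> :: "'a::field"
  assumes "r + \<xi> * s = p + \<xi> * q"
  shows "vol (vector [x, y, z, w]) (vector [a, a, a, a]) (vector [a, b, a, b])
      (vector [p, q, r, s]) = a * (b - a) * (s - q) * ((z + \<xi> * w) - (x + \<xi> * y))"
proof -
  \<comment> \<open>Eliminating \<open>p\<close> leaves a polynomial identity.\<close>
  have p: "p = r + \<xi> * s - \<xi> * q" using assms by simp
  show ?thesis
    unfolding vol_def det_def UNIV_4 p
    by (simp add: sum_over_permutations_insert permutes_sing sign_swap_id sign_id
        sign_compose permutation_swap_id permutation_compose swap_id_eq vector_def)
      (simp add: algebra_simps)
qed

theorem theorem2p8:
  fixes A :: "'a::{field,finite} set"
  assumes "real (card A) > sqrt (real CARD('a))"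
  shows "vol_set (cart_power4 A) = UNIV"
proof -
  have "real CARD('a) < real ((card A)\<^sup>2)"
    using power_strict_mono[OF assms, of 2] by simp
  then have "CARD('a) < (card A)\<^sup>2" by (simp only: of_nat_less_iff)
  then have q_less: "CARD('a) < card (A \<times> A)"
    by (simp add: card_cartesian_product power2_eq_square)
  obtain \<xi> where \<xi>: "CARD('a) < 2 * card ((\<lambda>u. fst u + \<xi> * snd u) ` (A \<times> A))"
    using exists_line_image_gt_half[of "A \<times> A"] q_less by auto
  have "\<not> inj_on (\<lambda>u. fst u + \<xi> * snd u) (A \<times> A)"
  proof
    assume "inj_on (\<lambda>u. fst u + \<xi> * snd u) (A \<times> A)"
    then have "card (A \<times> A) \<le> CARD('a)" by (rule card_inj_on_le) auto
    then show False using q_less by simp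
  qed
  then obtain p q r s where A: "p \<in> A" "q \<in> A" "r \<in> A" "s \<in> A"
      and eq: "r + \<xi> * s = p + \<xi> * q" and ne: "(r, s) \<noteq> (p, q)"
    by (auto simp: inj_on_def)
  \<comment> \<open>If \<open>s = q\<close>, then \<open>eq\<close> would force
    \<open>r = p\<close>.\<close>
  then have sq: "s \<noteq> q" by auto
  \<comment> \<open>One of the distinct elements \<open>q\<close>, \<open>s\<close> is nonzero: it
    serves as \<open>a\<close>, the other as \<open>b\<close>.\<close>
  have "\<exists>a\<in>A. \<exists>b\<in>A. a \<noteq> 0 \<and> b \<noteq> a" using A(2,4) sq by metis
  then obtain a b where ab: "a \<in> A" "b \<in> A" "a \<noteq> 0" "b \<noteq> a" by blast
  let ?c = "a * (b - a) * (s - q)"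
  have "t \<in> vol_set (cart_power4 A)" for t
  proof -
    \<comment> \<open>Dividing by \<open>?c\<close> offsets the fixed factor of the
      determinant.\<close>
    obtain u v where "u \<in> A \<times> A" "v \<in> A \<times> A"
        "t / ?c = (fst u + \<xi> * snd u) - (fst v + \<xi> * snd v)"
      using exists_diff_of_card_gt_half[OF \<xi>, of "t / ?c"] by auto
    then obtain x y z w where xyzw: "x \<in> A" "y \<in> A" "z \<in> A" "w \<in> A"
        and t: "t / ?c = (z + \<xi> * w) - (x + \<xi> * y)"
      by auto
    have "?c \<noteq> 0" using ab sq by simp
    then have "t = ?c * ((z + \<xi> * w) - (x + \<xi> * y))" by (simp flip: t)
    also have "\<dots> = vol (vector [x, y, z, w]) (vector [a, a, a, a]) (vector [a, b, a, b])
        (vector [p, q, r, s])"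
      using vol_eq_of_collision[OF eq] by simp
    finally have "t = \<dots>" .
    moreover have "vector [e, f, g, h] \<in> cart_power4 A"
      if "e \<in> A" "f \<in> A" "g \<in> A" "h \<in> A" for e f g h
      using that by (auto simp: cart_power4_def forall_4 vector_def)
    ultimately show ?thesis
      unfolding vol_set_def using A ab xyzw by blast
  qed
  then show ?thesis by auto
qed

end
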